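(* Let $c=2\lambda>0$. For any $\alpha(x,y)=\lambda\frac{\sin(2\lambda x+c_1(y))}{c_2(y)-\cos(2\lambda x+c_1(y))}$, the induced metric on a constant $p$-mean curvature surface with $2\lambda$ as its $p$-mean curvature and this $\alpha$ as its $\alpha$-function (in compatible coordinates $(x,y)$) is given by $$a=-\frac{\frac c2}{(1+\alpha^2)^{1/2}}+\frac{\frac c2\,c_2}{(c_2-\cos(cx+c_1))(1+\alpha^2)^{1/2}}+\frac{h(y)}{|c_2-\cos(cx+c_1)|(1+\alpha^2)^{1/2}}$$ and $$b=\frac{e^{k(y)}}{|c_2-\cos(cx+c_1)|(1+\alpha^2)^{1/2}},$$ for some functions $h(y)$ and $k(y)$, where $c_1=c_1(y)$, $c_2=c_2(y)$.
   Context: The Heisenberg group $H_1$ is $\mathbb{R}^3$ with the group law $(x_1,y_1,z_1)\circ(x_2,y_2,z_2)=(x_1+x_2,\,y_1+y_2,\,z_1+z_2+y_1x_2-x_1y_2)$. Left invariant fields: $\mathring e_1=\partial_x+y\partial_z$, $\mathring e_2=\partial_y-x\partial_z$, $T=\partial_z$. Contact form $\Theta=dz+x\,dy-y\,dx$, contact bundle $\xi=\ker\Theta$, $J\mathring e_1=\mathring e_2$, $J\mathring e_2=-\mathring e_1$. The adapted metric makes $\mathring e_1,\mathring e_2,T$ orthonormal; $\nabla$ is the connection for which they are parallel. All objects are $C^\infty$. For a surface $\Sigma\subset H_1$ without singular points (points with $T_p\Sigma=\xi_p$) choose a unit field $e_1\in T\Sigma\cap\xi$, $e_2=Je_1$;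 the $p$-mean curvature $H$ is defined by $\nabla_{e_1}e_2=-He_1$. The $\alpha$-function is defined by $\alpha e_2+T\in T\Sigma$; $\hat e_1=e_1$, $\hat e_2=\frac{\alpha e_2+T}{\sqrt{1+\alpha^2}}$ is an orthonormal frame of $T\Sigma$. Compatible coordinates $(x,y)$: $e_1=\partial_x$; then the induced metric is represented by the functions $a,b$ with $\hat e_2=a\,\partial_x+b\,\partial_y$, coordinates being taken with $b>0$. Coordinate domains are local, with connected $x$-slices, and $c_2-\cos(cx+c_1)\ne0$ on them. *)

theory Defs
  imports "HOL-Analysis.Analysis"
begin

text \<open>
  Smoothness of maps between (finite-dimensional) normed spaces; the set \<open>U\<close> is always open
  where these notions are used.
\<close>

primrec Ck_on :: "nat \<Rightarrow> ('a::real_normed_vector \<Rightarrow> 'b::real_normed_vector) \<Rightarrow> 'a set \<Rightarrow> bool" where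
  "Ck_on 0 f U \<longleftrightarrow> continuous_on U f"
| "Ck_on (Suc n) f U \<longleftrightarrow>
     (\<forall>x\<in>U. f differentiable (at x)) \<and> (\<forall>v. Ck_on n (\<lambda>x. frechet_derivative f (at x) v) U)"

definition smooth_on :: "('a::real_normed_vector \<Rightarrow> 'b::real_normed_vector) \<Rightarrow> 'a set \<Rightarrow> bool" where
  "smooth_on f U \<longleftrightarrow> (\<forall>n. Ck_on n f U)"


subsection \<open>The Heisenberg group\<close>

text \<open>
  Points of the Heisenberg group and tangent vectors at a point are both elements of \<open>real^3\<close>;
  a tangent vector is given by its components with respect to \<open>\<partial>\<^sub>x, \<partial>\<^sub>y, \<partial>\<^sub>z\<close>.
\<close>

definition E1 :: "real^3 \<Rightarrow> real^3" where "E1 p = vector [1, 0, p$2]"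
definition E2 :: "real^3 \<Rightarrow> real^3" where "E2 p = vector [0, 1, - p$1]"
definition Reeb :: "real^3 \<Rightarrow> real^3" where "Reeb p = vector [0, 0, 1]"

definition contact_form :: "real^3 \<Rightarrow> real^3 \<Rightarrow> real" where
  "contact_form p v = v$3 + p$1 * v$2 - p$2 * v$1"

definition contact_plane :: "real^3 \<Rightarrow> (real^3) set" where
  "contact_plane p = {v. contact_form p v = 0}"

text \<open>Components of a tangent vector at \<open>p\<close> with respect to \<open>E1, E2, Reeb\<close>.\<close>

definition frame_comps :: "real^3 \<Rightarrow> real^3 \<Rightarrow> real^3" where
  "frame_comps p v = vector [v$1, v$2, contact_form p v]"

lemma frame_comps_expansion:
  "v = frame_comps p v $ 1 *\<^sub>R E1 p + frame_comps p v $ 2 *\<^sub>R E2 p + frame_comps p v $ 3 *\<^sub>R Reeb p"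
  by (simp add: vec_eq_iff forall_3 frame_comps_def contact_form_def E1_def E2_def Reeb_def)

definition adapted_metric :: "real^3 \<Rightarrow> real^3 \<Rightarrow> real^3 \<Rightarrow> real" where
  "adapted_metric p u v = frame_comps p u \<bullet> frame_comps p v"

lemma adapted_metric_orthonormal:
  "adapted_metric p (E1 p) (E1 p) = 1" "adapted_metric p (E2 p) (E2 p) = 1"
  "adapted_metric p (Reeb p) (Reeb p) = 1" "adapted_metric p (E1 p) (E2 p) = 0"
  "adapted_metric p (E1 p) (Reeb p) = 0" "adapted_metric p (E2 p) (Reeb p) = 0"
  by (simp_all add: adapted_metric_def frame_comps_def contact_form_def E1_def E2_def Reeb_def
      inner_vec_def sum_3)

text \<open>Only used on the contact plane, where it is the rotation \<open>E1 \<mapsto> E2\<close>, \<open>E2 \<mapsto> - E1\<close>.\<close>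

definition J :: "real^3 \<Rightarrow> real^3 \<Rightarrow> real^3" where
  "J p v = frame_comps p v $ 1 *\<^sub>R E2 p - frame_comps p v $ 2 *\<^sub>R E1 p"

lemma J_frame: "J p (E1 p) = E2 p" "J p (E2 p) = - E1 p"
  by (simp_all add: J_def frame_comps_def E1_def E2_def)


subsection \<open>Surfaces\<close>

definition local_parametrization ::
    "(real^3) set \<Rightarrow> (real \<times> real) set \<Rightarrow> (real \<times> real \<Rightarrow> real^3) \<Rightarrow> bool" where
  "local_parametrization S U X \<longleftrightarrow>
     open U \<and> smooth_on X U \<and> (\<forall>q\<in>U. inj (frechet_derivative X (at q))) \<and>
     openin (top_of_set S) (X ` U) \<and> (\<exists>Y. homeomorphism U (X ` U) X Y)"

definition regular_surface :: "(real^3) set \<Rightarrow> bool" where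
  "regular_surface S \<longleftrightarrow> (\<forall>p\<in>S. \<exists>U X. local_parametrization S U X \<and> p \<in> X ` U)"

definition smooth_on_surface :: "(real^3) set \<Rightarrow> (real^3 \<Rightarrow> 'b::real_normed_vector) \<Rightarrow> bool" where
  "smooth_on_surface S f \<longleftrightarrow> (\<forall>U X. local_parametrization S U X \<longrightarrow> smooth_on (f \<circ> X) U)"

definition curve_through :: "(real^3) set \<Rightarrow> real^3 \<Rightarrow> real^3 \<Rightarrow> (real \<Rightarrow> real^3) \<Rightarrow> bool" where
  "curve_through S p v \<gamma> \<longleftrightarrow>
     (\<exists>\<epsilon>>0. smooth_on \<gamma> {-\<epsilon><..<\<epsilon>} \<and> \<gamma> ` {-\<epsilon><..<\<epsilon>} \<subseteq> S) \<and>
     \<gamma> 0 = p \<and> (\<gamma> has_vector_derivative v) (at 0)"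

definition tangent_space :: "(real^3) set \<Rightarrow> real^3 \<Rightarrow> (real^3) set" where
  "tangent_space S p = {v. \<exists>\<gamma>. curve_through S p v \<gamma>}"

definition singular_point :: "(real^3) set \<Rightarrow> real^3 \<Rightarrow> bool" where
  "singular_point S p \<longleftrightarrow> p \<in> S \<and> tangent_space S p = contact_plane p"

text \<open>
  \<open>\<nabla>\<^sub>v W = w\<close> at \<open>p\<close> for a vector field \<open>W\<close> of the ambient space given along \<open>S\<close> and a vector \<open>v\<close>
  tangent to \<open>S\<close>. Since \<open>E1, E2, Reeb\<close> are parallel, \<open>\<nabla>\<^sub>v\<close> differentiates the components in
  this frame, here along the curves in \<open>S\<close> with velocity \<open>v\<close>.
\<close>

definition has_cov_derivative ::
    "(real^3) set \<Rightarrow> (real^3 \<Rightarrow> real^3) \<Rightarrow> real^3 \<Rightarrow> real^3 \<Rightarrow> real^3 \<Rightarrow> bool" where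
  "has_cov_derivative S W p v w \<longleftrightarrow>
     v \<in> tangent_space S p \<and>
     (\<forall>\<gamma>. curve_through S p v \<gamma> \<longrightarrow>
        ((\<lambda>t. frame_comps (\<gamma> t) (W (\<gamma> t))) has_vector_derivative frame_comps p w) (at 0))"

definition characteristic_field :: "(real^3) set \<Rightarrow> (real^3 \<Rightarrow> real^3) \<Rightarrow> bool" where
  "characteristic_field S e1 \<longleftrightarrow>
     smooth_on_surface S e1 \<and>
     (\<forall>p\<in>S. e1 p \<in> tangent_space S p \<inter> contact_plane p \<and> adapted_metric p (e1 p) (e1 p) = 1)"

definition p_mean_curvature ::
    "(real^3) set \<Rightarrow> (real^3 \<Rightarrow> real^3) \<Rightarrow> (real^3 \<Rightarrow> real) \<Rightarrow> bool" where
  "p_mean_curvature S e1 H \<longleftrightarrow>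
     (\<forall>p\<in>S. has_cov_derivative S (\<lambda>q. J q (e1 q)) p (e1 p) (- H p *\<^sub>R e1 p))"

definition alpha_function ::
    "(real^3) set \<Rightarrow> (real^3 \<Rightarrow> real^3) \<Rightarrow> (real^3 \<Rightarrow> real) \<Rightarrow> bool" where
  "alpha_function S e1 \<alpha> \<longleftrightarrow>
     (\<forall>p\<in>S. \<alpha> p *\<^sub>R J p (e1 p) + Reeb p \<in> tangent_space S p)"

definition e2_hat :: "(real^3 \<Rightarrow> real^3) \<Rightarrow> (real^3 \<Rightarrow> real) \<Rightarrow> real^3 \<Rightarrow> real^3" where
  "e2_hat e1 \<alpha> p = (1 / sqrt (1 + (\<alpha> p)\<^sup>2)) *\<^sub>R (\<alpha> p *\<^sub>R J p (e1 p) + Reeb p)"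

text \<open>The coordinate fields \<open>\<partial>\<^sub>x\<close> and \<open>\<partial>\<^sub>y\<close> of a parametrization.\<close>

definition coord_x :: "(real \<times> real \<Rightarrow> real^3) \<Rightarrow> real \<times> real \<Rightarrow> real^3" where
  "coord_x X q = frechet_derivative X (at q) (1, 0)"

definition coord_y :: "(real \<times> real \<Rightarrow> real^3) \<Rightarrow> real \<times> real \<Rightarrow> real^3" where
  "coord_y X q = frechet_derivative X (at q) (0, 1)"

definition compatible_coordinates ::
    "(real^3) set \<Rightarrow> (real^3 \<Rightarrow> real^3) \<Rightarrow> (real \<times> real) set \<Rightarrow> (real \<times> real \<Rightarrow> real^3) \<Rightarrow> bool" where
  "compatible_coordinates S e1 U X \<longleftrightarrow>
     local_parametrization S U X \<and> (\<forall>q\<in>U. coord_x X q = e1 (X q))"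

definition metric_representation ::
    "(real^3 \<Rightarrow> real^3) \<Rightarrow> (real^3 \<Rightarrow> real) \<Rightarrow> (real \<times> real) set \<Rightarrow> (real \<times> real \<Rightarrow> real^3) \<Rightarrow>
     (real \<times> real \<Rightarrow> real) \<Rightarrow> (real \<times> real \<Rightarrow> real) \<Rightarrow> bool" where
  "metric_representation e1 \<alpha> U X a b \<longleftrightarrow>
     (\<forall>q\<in>U. e2_hat e1 \<alpha> (X q) = a q *\<^sub>R coord_x X q + b q *\<^sub>R coord_y X q)"

end

theory Submission
  imports Defs
begin

text \<open>
  In compatible coordinates write \<open>X = (X\<^sub>1, X\<^sub>2, X\<^sub>3)\<close> for the parametrization and
  \<open>e\<^sub>1 = u E1 + v E2\<close>. Along the \<open>x\<close>-lines the curvature condition says \<open>u\<^sub>x = - c v\<close>, \<open>v\<^sub>x = c u\<close>.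
  Let \<open>s\<close>, \<open>w\<close>, \<open>t\<close> be the components of \<open>\<partial>\<^sub>y\<close> with respect to \<open>e\<^sub>1\<close>, \<open>J e\<^sub>1\<close>, \<open>Reeb\<close>. Comparing the
  mixed second derivatives of \<open>X\<close> gives \<open>s\<^sub>x = c w\<close> and \<open>t\<^sub>x = 2 w\<close>, while the metric representation says
  \<open>b = 1 / (t \<rho>)\<close>, \<open>a = - s / (t \<rho>)\<close> and \<open>w = \<alpha> t\<close> with \<open>\<rho>\<^sup>2 = 1 + \<alpha>\<^sup>2\<close>. For the given \<open>\<alpha>\<close>, with
  \<open>D = c\<^sub>2 - cos (c x + c\<^sub>1)\<close> and \<open>2 \<alpha> = D\<^sub>x / D\<close>, the quantities \<open>g = D / t\<close> and
  \<open>f = s + (c / 2) cos (c x + c\<^sub>1) / g\<close> therefore do not depend on \<open>x\<close>, and one takes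
  \<open>k = ln \<bar>g\<bar>\<close>, \<open>h = - f \<bar>g\<bar>\<close>.
\<close>

subsection \<open>Calculus of smooth maps\<close>

lemma Ck_on_cong:
  assumes "open U" "\<And>x. x \<in> U \<Longrightarrow> f x = g x" "Ck_on n f U"
  shows "Ck_on n g U"
  using assms
proof (induction n arbitrary: f g)
  case 0
  then show ?case by (simp cong: continuous_on_cong)
next
  case (Suc n)
  have diff: "g differentiable (at x)" if "x \<in> U" for x
    using Suc.prems that unfolding differentiable_def Ck_on.simps
    by (metis has_derivative_transform_within_open)
  have "frechet_derivative f (at x) v = frechet_derivative g (at x) v" if "x \<in> U" for x v
    using frechet_derivative_transform_within_open[of f x U g] Suc.prems that by simp
  then have "Ck_on n (\<lambda>x. frechet_derivative g (at x) v) U" for v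
    using Suc.IH[OF \<open>open U\<close>, of "\<lambda>x. frechet_derivative f (at x) v"] Suc.prems by simp
  with diff show ?case by simp
qed

text \<open>By uniqueness of the derivative, any explicit \<open>f'\<close> may stand in for
  \<open>frechet_derivative\<close>; the closure proofs below run their inductions on this
  form.\<close>

lemma Ck_on_SucI:
  assumes "open U" "\<And>x. x \<in> U \<Longrightarrow> (f has_derivative f' x) (at x)" "\<And>v. Ck_on n (\<lambda>x. f' x v) U"
  shows "Ck_on (Suc n) f U"
proof -
  have "f' x v = frechet_derivative f (at x) v" if "x \<in> U" for x v
    using assms(2)[OF that] frechet_derivative_at by metis
  then have "Ck_on n (\<lambda>x. frechet_derivative f (at x) v) U" for v
    using Ck_on_cong[OF assms(1) _ assms(3)[of v]] by simp
  then show ?thesis using assms(2) by (auto simp: differentiable_def)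
qed

lemma Ck_on_Suc_has_derivative:
  assumes "Ck_on (Suc n) f U" "x \<in> U"
  shows "(f has_derivative frechet_derivative f (at x)) (at x)"
  using assms by (simp add: frechet_derivative_works[symmetric])

lemma Ck_on_SucD: "Ck_on (Suc n) f U \<Longrightarrow> Ck_on n f U"
proof (induction n arbitrary: f)
  case 0
  then show ?case
    by (auto intro!: continuous_at_imp_continuous_on differentiable_imp_continuous_within)
next
  case (Suc n)
  then show ?case by (metis Ck_on.simps(2))
qed

lemma Ck_on_local:
  assumes "\<And>x. x \<in> U \<Longrightarrow> \<exists>V. open V \<and> x \<in> V \<and> Ck_on n f V"
  shows "Ck_on n f U"
  using assms
proof (induction n arbitrary: f)
  case 0
  then show ?case
    by (simp add: continuous_on_eq_continuous_at continuous_at_imp_continuous_on)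
      (metis continuous_at_imp_continuous_on continuous_on_eq_continuous_at)
next
  case (Suc n)
  have "Ck_on n (\<lambda>x. frechet_derivative f (at x) v) U" for v
    using Suc.prems by (intro Suc.IH) fastforce
  then show ?case using Suc.prems by fastforce
qed

lemma Ck_on_const: "Ck_on n (\<lambda>x. k) U"
  by (induction n arbitrary: k) simp_all

lemma Ck_on_add:
  assumes "open U" "Ck_on n f U" "Ck_on n g U"
  shows "Ck_on n (\<lambda>x. f x + g x) U"
  using assms(2,3)
proof (induction n arbitrary: f g)
  case 0
  then show ?case by (simp add: continuous_on_add)
next
  case (Suc n)
  show ?case
  proof (rule Ck_on_SucI[OF \<open>open U\<close>])
    show "((\<lambda>x. f x + g x) has_derivative
        (\<lambda>v. frechet_derivative f (at x) v + frechet_derivative g (at x) v)) (at x)" if "x \<in> U" for x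
      using Suc.prems that by (intro has_derivative_add Ck_on_Suc_has_derivative)
  qed (use Suc in auto)
qed

lemma Ck_on_mult:
  fixes f g :: "'a::real_normed_vector \<Rightarrow> real"
  assumes "open U" "Ck_on n f U" "Ck_on n g U"
  shows "Ck_on n (\<lambda>x. f x * g x) U"
  using assms(2,3)
proof (induction n arbitrary: f g)
  case 0
  then show ?case by (simp add: continuous_on_mult)
next
  case (Suc n)
  show ?case
  proof (rule Ck_on_SucI[OF \<open>open U\<close>])
    show "((\<lambda>x. f x * g x) has_derivative
        (\<lambda>v. f x * frechet_derivative g (at x) v + frechet_derivative f (at x) v * g x)) (at x)"
      if "x \<in> U" for x
      using Suc.prems that by (intro has_derivative_mult Ck_on_Suc_has_derivative)
    \<comment> \<open>The product rule keeps undifferentiated factors, so the induction hypothesis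
      needs \<open>f\<close> and \<open>g\<close> at order \<open>n\<close> as well;
      \<open>Ck_on_SucD\<close> supplies this.\<close>
    show "Ck_on n (\<lambda>x. f x * frechet_derivative g (at x) v + frechet_derivative f (at x) v * g x) U"
      for v
      using Suc.prems Suc.prems[THEN Ck_on_SucD] \<open>open U\<close> by (intro Ck_on_add Suc.IH) auto
  qed
qed

lemma Ck_on_bounded_linear:
  assumes "bounded_linear L" "open U" "Ck_on n f U"
  shows "Ck_on n (\<lambda>x. L (f x)) U"
  using assms(3)
proof (induction n arbitrary: f)
  case 0
  then show ?case using assms by (simp add: bounded_linear.continuous_on)
next
  case (Suc n)
  show ?case
  proof (rule Ck_on_SucI[OF \<open>open U\<close>])
    show "((\<lambda>x. L (f x)) has_derivative (\<lambda>v. L (frechet_derivative f (at x) v))) (at x)"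
      if "x \<in> U" for x
      using bounded_linear.has_derivative[OF assms(1) Ck_on_Suc_has_derivative[OF Suc.prems that]] .
  qed (use Suc in simp)
qed

text \<open>The inner map has constant derivative \<open>L\<close>, so each directional derivative
  of the composite is again a function composed with the same affine map. This serves restriction to
  lines and slices.\<close>

lemma Ck_on_affine:
  assumes "bounded_linear L" "open U" "open V" "Ck_on n f V" "\<And>x. x \<in> U \<Longrightarrow> p + L x \<in> V"
  shows "Ck_on n (\<lambda>x. f (p + L x)) U"
  using assms(4)
proof (induction n arbitrary: f)
  case 0
  have "continuous_on U (\<lambda>x. p + L x)"
    by (intro continuous_on_add continuous_on_const bounded_linear.continuous_on[OF assms(1)]
        continuous_on_id)
  with 0 show ?case using assms(5) by (auto intro: continuous_on_compose2[of V f])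
next
  case (Suc n)
  show ?case
  proof (rule Ck_on_SucI[OF \<open>open U\<close>])
    fix x assume "x \<in> U"
    have "((\<lambda>x. p + L x) has_derivative L) (at x)"
      using has_derivative_add[OF has_derivative_const bounded_linear_imp_has_derivative[OF assms(1)]]
      by simp
    from has_derivative_compose[OF this Ck_on_Suc_has_derivative[OF Suc.prems assms(5)[OF \<open>x \<in> U\<close>]]]
    show "((\<lambda>x. f (p + L x)) has_derivative
        (\<lambda>v. frechet_derivative f (at (p + L x)) (L v))) (at x)" .
  qed (use Suc in auto)
qed

lemma Ck_on_compose:
  fixes f :: "'a::real_normed_vector \<Rightarrow> real" and g :: "real \<Rightarrow> real"
  assumes "open U" "Ck_on n f U" "Ck_on n g V" "f ` U \<subseteq> V"
  shows "Ck_on n (\<lambda>x. g (f x)) U"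
  using assms(2,3)
proof (induction n arbitrary: g)
  case 0
  then show ?case using assms(4) by (auto intro: continuous_on_compose2)
next
  case (Suc n)
  show ?case
  proof (rule Ck_on_SucI[OF \<open>open U\<close>])
    fix x assume "x \<in> U"
    then have "f x \<in> V" using assms(4) by auto
    \<comment> \<open>On the real line a derivative is multiplication by its value at 1. This turns
      the chain rule into a product of real functions, to which \<open>Ck_on_mult\<close>
      applies.\<close>
    have lin: "frechet_derivative g (at (f x)) r = r * frechet_derivative g (at (f x)) 1" for r
      using linear_cmul[OF linear_frechet_derivative, of g "at (f x)" r 1] Suc.prems \<open>f x \<in> V\<close>
      by simp
    from has_derivative_compose[OF Ck_on_Suc_has_derivative[OF Suc.prems(1) \<open>x \<in> U\<close>]
        Ck_on_Suc_has_derivative[OF Suc.prems(2) \<open>f x \<in> V\<close>]]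
    show "((\<lambda>x. g (f x)) has_derivative
        (\<lambda>v. frechet_derivative f (at x) v * frechet_derivative g (at (f x)) 1)) (at x)"
      by (subst (asm) lin)
  next
    show "Ck_on n (\<lambda>x. frechet_derivative f (at x) v * frechet_derivative g (at (f x)) 1) U" for v
      using Suc.prems Ck_on_SucD[OF Suc.prems(1)] \<open>open U\<close>
      by (intro Ck_on_mult Suc.IH[of "\<lambda>y. frechet_derivative g (at y) 1"]) auto
  qed
qed

lemma Ck_on_SucI_real:
  fixes f :: "real \<Rightarrow> real"
  assumes "open U" "\<And>x. x \<in> U \<Longrightarrow> (f has_real_derivative f' x) (at x)" "Ck_on n f' U"
  shows "Ck_on (Suc n) f U"
  using assms
  by (intro Ck_on_SucI[where f' = "\<lambda>x v. f' x * v"] Ck_on_mult Ck_on_const)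
    (auto simp: has_field_derivative_def)

section \<open>Smoothness of the elementary functions\<close>

lemma smooth_on_exp: "smooth_on (exp :: real \<Rightarrow> real) UNIV"
proof -
  have "Ck_on n (exp :: real \<Rightarrow> real) UNIV" for n
  proof (induction n)
    case (Suc n)
    then show ?case by (intro Ck_on_SucI_real[where f' = exp]) (auto intro: DERIV_exp)
  qed (simp add: continuous_on_exp)
  then show ?thesis by (simp add: smooth_on_def)
qed

lemma smooth_on_cos: "smooth_on (cos :: real \<Rightarrow> real) UNIV"
proof -
  \<comment> \<open>The span of \<open>cos\<close> and \<open>sin\<close> is closed under
    differentiation, so arbitrary coefficients let the induction close.\<close>
  have "Ck_on n (\<lambda>x::real. k * cos x + l * sin x) UNIV" for n k l
  proof (induction n arbitrary: k l)
    case (Suc n)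
    show ?case
      by (rule Ck_on_SucI_real[where f' = "\<lambda>x. l * cos x + (- k) * sin x"])
        (use Suc[of l "- k"] in \<open>auto intro!: derivative_eq_intros\<close>)
  qed (simp add: continuous_on_add continuous_on_mult continuous_on_cos continuous_on_sin)
  from this[of _ 1 0] show ?thesis by (simp add: smooth_on_def)
qed

lemma smooth_on_inverse: "smooth_on (inverse :: real \<Rightarrow> real) (- {0})"
proof -
  have "Ck_on n (inverse :: real \<Rightarrow> real) (- {0})" for n
  proof (induction n)
    case (Suc n)
    show ?case
    proof (rule Ck_on_SucI_real)
      \<comment> \<open>The derivative is written through \<open>inverse\<close> itself, so that the
        product rule and the induction hypothesis apply to it.\<close>
      show "(inverse has_real_derivative - 1 * (inverse x * inverse x)) (at x)" if "x \<in> - {0}" for x :: real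
        using DERIV_inverse[of x] that by (simp add: power2_eq_square)
      show "Ck_on n (\<lambda>x::real. - 1 * (inverse x * inverse x)) (- {0})"
        by (intro Ck_on_mult Ck_on_const Suc open_Compl closed_singleton)
    qed (rule open_Compl[OF closed_singleton])
  qed (simp add: continuous_on_inverse)
  then show ?thesis by (simp add: smooth_on_def)
qed

text \<open>The derivative is \<open>inverse\<close> on both half-lines, so smoothness is inherited
  from there. The absolute value is needed because the function \<open>g\<close> of the final proof
  has the sign of \<open>D\<close>, which may be negative.\<close>

lemma smooth_on_ln_abs: "smooth_on (\<lambda>x::real. ln \<bar>x\<bar>) (- {0})"
proof -
  have deriv: "((\<lambda>x. ln \<bar>x\<bar>) has_real_derivative inverse x) (at x)" if "x \<in> - {0}" for x :: real
  proof (cases "x > 0")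
    case True
    then have "(ln has_real_derivative inverse x) (at x)" by (rule DERIV_ln)
    then show ?thesis
      by (rule has_field_derivative_transform_within_open[of _ _ _ "{0<..}"]) (use True in auto)
  next
    case False
    with that have "((\<lambda>x. ln (- x)) has_real_derivative inverse x) (at x)"
      by (auto intro!: derivative_eq_intros simp: field_simps)
    then show ?thesis
      by (rule has_field_derivative_transform_within_open[of _ _ _ "{..<0}"]) (use that False in auto)
  qed
  have "Ck_on n (\<lambda>x::real. ln \<bar>x\<bar>) (- {0})" for n
    by (rule Ck_on_SucD, rule Ck_on_SucI_real[OF open_Compl[OF closed_singleton] deriv])
      (use smooth_on_inverse in \<open>simp_all add: smooth_on_def\<close>)
  then show ?thesis by (simp add: smooth_on_def)
qed

section \<open>Closure rules for smooth functions\<close>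

lemma smooth_on_differentiable: "smooth_on f U \<Longrightarrow> x \<in> U \<Longrightarrow> f differentiable (at x)"
  unfolding smooth_on_def by (metis Ck_on.simps(2))

lemma smooth_on_frechet_derivative:
  "smooth_on f U \<Longrightarrow> smooth_on (\<lambda>x. frechet_derivative f (at x) v) U"
  unfolding smooth_on_def by (metis Ck_on.simps(2))

lemma smooth_on_imp_continuous_on: "smooth_on f U \<Longrightarrow> continuous_on U f"
  unfolding smooth_on_def by (metis Ck_on.simps(1))

lemma smooth_on_const: "smooth_on (\<lambda>x. k) U"
  by (simp add: smooth_on_def Ck_on_const)

lemma smooth_on_ident: "open U \<Longrightarrow> smooth_on (\<lambda>x. x) U"
  unfolding smooth_on_def
proof (rule allI)
  fix n assume "open U"
  then show "Ck_on n (\<lambda>x. x) U"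
    by (cases n) (auto intro!: continuous_on_id Ck_on_SucI has_derivative_ident Ck_on_const simp del: Ck_on.simps(2))
qed

lemma smooth_on_add:
  "open U \<Longrightarrow> smooth_on f U \<Longrightarrow> smooth_on g U \<Longrightarrow> smooth_on (\<lambda>x. f x + g x) U"
  by (simp add: smooth_on_def Ck_on_add)

lemma smooth_on_mult:
  fixes f g :: "'a::real_normed_vector \<Rightarrow> real"
  shows "open U \<Longrightarrow> smooth_on f U \<Longrightarrow> smooth_on g U \<Longrightarrow> smooth_on (\<lambda>x. f x * g x) U"
  by (simp add: smooth_on_def Ck_on_mult)

lemma smooth_on_diff:
  fixes f g :: "'a::real_normed_vector \<Rightarrow> real"
  assumes "open U" "smooth_on f U" "smooth_on g U"
  shows "smooth_on (\<lambda>x. f x - g x) U"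
  using smooth_on_add[OF assms(1,2) smooth_on_mult[OF assms(1) smooth_on_const[of "-1"] assms(3)]]
  by simp

lemma smooth_on_bounded_linear:
  "bounded_linear L \<Longrightarrow> open U \<Longrightarrow> smooth_on f U \<Longrightarrow> smooth_on (\<lambda>x. L (f x)) U"
  by (simp add: smooth_on_def Ck_on_bounded_linear)

lemma smooth_on_affine:
  assumes "bounded_linear L" "open U" "open V" "smooth_on f V" "\<And>x. x \<in> U \<Longrightarrow> p + L x \<in> V"
  shows "smooth_on (\<lambda>x. f (p + L x)) U"
  using assms by (simp add: smooth_on_def Ck_on_affine)

lemma smooth_on_compose:
  fixes f :: "'a::real_normed_vector \<Rightarrow> real" and g :: "real \<Rightarrow> real"
  shows "open U \<Longrightarrow> smooth_on f U \<Longrightarrow> smooth_on g V \<Longrightarrow> f ` U \<subseteq> V \<Longrightarrow> smooth_on (\<lambda>x. g (f x)) U"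
  unfolding smooth_on_def by (blast intro: Ck_on_compose)

lemma smooth_on_divide:
  fixes f g :: "'a::real_normed_vector \<Rightarrow> real"
  assumes "open U" "smooth_on f U" "smooth_on g U" "\<And>x. x \<in> U \<Longrightarrow> g x \<noteq> 0"
  shows "smooth_on (\<lambda>x. f x / g x) U"
  unfolding divide_inverse using assms
  by (intro smooth_on_mult smooth_on_compose[OF _ _ smooth_on_inverse]) auto

lemma smooth_on_local:
  assumes "\<And>x. x \<in> U \<Longrightarrow> \<exists>V. open V \<and> x \<in> V \<and> smooth_on f V"
  shows "smooth_on f U"
  unfolding smooth_on_def
proof (intro allI Ck_on_local)
  show "\<exists>V. open V \<and> x \<in> V \<and> Ck_on n f V" if "x \<in> U" for n x
    using assms[OF that] unfolding smooth_on_def by metis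
qed

lemma smooth_on_cong:
  "open U \<Longrightarrow> (\<And>x. x \<in> U \<Longrightarrow> f x = g x) \<Longrightarrow> smooth_on f U \<Longrightarrow> smooth_on g U"
  unfolding smooth_on_def by (metis Ck_on_cong)

lemma smooth_on_snd:
  fixes f :: "real \<Rightarrow> real"
  assumes "open U" "smooth_on f (snd ` U)"
  shows "smooth_on (\<lambda>q. f (snd q)) (U :: (real \<times> real) set)"
  using smooth_on_affine[OF bounded_linear_snd \<open>open U\<close> open_image_snd[OF \<open>open U\<close>] assms(2), of 0]
  by auto


subsection \<open>Symmetry of second derivatives\<close>

lemma line_has_vector_derivative:
  fixes f :: "'a::real_normed_vector \<Rightarrow> 'b::real_normed_vector"
  assumes "f differentiable (at (p + r *\<^sub>R v))"
  shows "((\<lambda>r. f (p + r *\<^sub>R v)) has_vector_derivative frechet_derivative f (at (p + r *\<^sub>R v)) v) (at r)"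
proof -
  have "((\<lambda>r. p + r *\<^sub>R v) has_derivative (\<lambda>h. h *\<^sub>R v)) (at r)"
    by (auto intro!: derivative_eq_intros)
  from has_derivative_compose[OF this assms[unfolded frechet_derivative_works]]
  show ?thesis
    unfolding has_vector_derivative_def linear_cmul[OF linear_frechet_derivative[OF assms]] .
qed

lemma line_has_real_derivative:
  fixes f :: "'a::real_normed_vector \<Rightarrow> real"
  assumes "f differentiable (at (p + r *\<^sub>R v))"
  shows "((\<lambda>r. f (p + r *\<^sub>R v)) has_real_derivative frechet_derivative f (at (p + r *\<^sub>R v)) v) (at r)"
  using line_has_vector_derivative[OF assms] by (simp add: has_real_derivative_iff_has_vector_derivative)

text \<open>Two applications of the mean value theorem: first along \<open>v\<close> to the
  difference of \<open>f\<close> on two parallel sides of the parallelogram, then along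
  \<open>w\<close> to the resulting first derivative.\<close>

lemma second_difference_mvt:
  fixes f :: "'a::real_normed_vector \<Rightarrow> real"
  assumes "s > 0"
    and sq: "\<And>i j. \<lbrakk>0 \<le> i; i \<le> s; 0 \<le> j; j \<le> s\<rbrakk> \<Longrightarrow> x + i *\<^sub>R v + j *\<^sub>R w \<in> U"
    and f: "\<And>p. p \<in> U \<Longrightarrow> f differentiable (at p)"
    and f': "\<And>p. p \<in> U \<Longrightarrow> (\<lambda>p. frechet_derivative f (at p) v) differentiable (at p)"
  shows "\<exists>i j. 0 < i \<and> i < s \<and> 0 < j \<and> j < s \<and>
    f (x + s *\<^sub>R v + s *\<^sub>R w) - f (x + s *\<^sub>R v) - f (x + s *\<^sub>R w) + f x =
      s * s * frechet_derivative (\<lambda>p. frechet_derivative f (at p) v) (at (x + i *\<^sub>R v + j *\<^sub>R w)) w"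
proof -
  define fv where "fv = (\<lambda>p. frechet_derivative f (at p) v)"
  \<comment> \<open>The increment of \<open>\<phi>\<close> from 0 to \<open>s\<close> is the second
    difference of \<open>f\<close>.\<close>
  define \<phi> where "\<phi> r = f (x + s *\<^sub>R w + r *\<^sub>R v) - f (x + r *\<^sub>R v)" for r
  have "\<exists>i>0. i < s \<and> \<phi> s - \<phi> 0 = (s - 0) * (fv (x + s *\<^sub>R w + i *\<^sub>R v) - fv (x + i *\<^sub>R v))"
  proof (rule MVT2[OF \<open>s > 0\<close>])
    show "(\<phi> has_real_derivative (fv (x + s *\<^sub>R w + r *\<^sub>R v) - fv (x + r *\<^sub>R v))) (at r)"
      if "0 \<le> r" "r \<le> s" for r
      unfolding \<phi>_def fv_def using sq[of r s] sq[of r 0] that \<open>s > 0\<close>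
      by (intro DERIV_diff line_has_real_derivative f) (simp_all add: algebra_simps)
  qed
  then obtain i where i: "0 < i" "i < s"
    and \<phi>: "\<phi> s - \<phi> 0 = (s - 0) * (fv (x + s *\<^sub>R w + i *\<^sub>R v) - fv (x + i *\<^sub>R v))"
    by blast
  have "\<exists>j>0. j < s \<and> fv (x + i *\<^sub>R v + s *\<^sub>R w) - fv (x + i *\<^sub>R v + 0 *\<^sub>R w) =
      (s - 0) * frechet_derivative fv (at (x + i *\<^sub>R v + j *\<^sub>R w)) w"
  proof (rule MVT2[OF \<open>s > 0\<close>])
    show "((\<lambda>r. fv (x + i *\<^sub>R v + r *\<^sub>R w)) has_real_derivative
      frechet_derivative fv (at (x + i *\<^sub>R v + r *\<^sub>R w)) w) (at r)" if "0 \<le> r" "r \<le> s" for r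
      using sq[of i r] that i unfolding fv_def by (intro line_has_real_derivative f') simp
  qed
  then obtain j where j: "0 < j" "j < s"
    and "fv (x + i *\<^sub>R v + s *\<^sub>R w) - fv (x + i *\<^sub>R v + 0 *\<^sub>R w) =
      (s - 0) * frechet_derivative fv (at (x + i *\<^sub>R v + j *\<^sub>R w)) w"
    by blast
  then have "\<phi> s - \<phi> 0 = s * (s * frechet_derivative fv (at (x + i *\<^sub>R v + j *\<^sub>R w)) w)"
    using \<phi> by (simp add: algebra_simps)
  then have "f (x + s *\<^sub>R v + s *\<^sub>R w) - f (x + s *\<^sub>R v) - f (x + s *\<^sub>R w) + f x =
      s * s * frechet_derivative fv (at (x + i *\<^sub>R v + j *\<^sub>R w)) w"
    unfolding \<phi>_def by (simp add: algebra_simps)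
  with i j show ?thesis unfolding fv_def by blast
qed

text \<open>Schwarz's theorem. By continuity, second derivatives that differ at \<open>x\<close>
  take separated values nearby; second differences over a small parallelogram rule this out.\<close>

lemma frechet_derivative_commute:
  fixes f :: "'a::real_normed_vector \<Rightarrow> real"
  assumes "open U" "smooth_on f U" "x \<in> U"
  shows "frechet_derivative (\<lambda>p. frechet_derivative f (at p) v) (at x) w =
    frechet_derivative (\<lambda>p. frechet_derivative f (at p) w) (at x) v"
proof (rule ccontr)
  define F where "F v w p = frechet_derivative (\<lambda>p. frechet_derivative f (at p) v) (at p) w" for v w p
  assume "\<not> ?thesis"
  then have ne: "\<bar>F v w x - F w v x\<bar> > 0" unfolding F_def by simp
  have "continuous_on U (F v w)" for v w
    unfolding F_def using assms by (intro smooth_on_imp_continuous_on smooth_on_frechet_derivative)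
  then have cont: "isCont (F v w) x" for v w
    using assms by (simp add: continuous_on_eq_continuous_at)
  \<comment> \<open>Half the gap: a number cannot be closer than this to both of the two different
    values at \<open>x\<close>.\<close>
  define \<epsilon> where "\<epsilon> = \<bar>F v w x - F w v x\<bar> / 2"
  have "\<epsilon> > 0" using ne by (simp add: \<epsilon>_def)
  obtain d1 where d1: "d1 > 0" "\<And>p. dist p x < d1 \<Longrightarrow> dist (F v w p) (F v w x) < \<epsilon>"
    using cont[of v w] \<open>\<epsilon> > 0\<close> unfolding continuous_at_eps_delta by (metis dist_commute)
  obtain d2 where d2: "d2 > 0" "\<And>p. dist p x < d2 \<Longrightarrow> dist (F w v p) (F w v x) < \<epsilon>"
    using cont[of w v] \<open>\<epsilon> > 0\<close> unfolding continuous_at_eps_delta by (metis dist_commute)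
  obtain d3 where d3: "d3 > 0" "\<And>p. dist p x < d3 \<Longrightarrow> p \<in> U"
    using assms unfolding open_dist by blast
  define d where "d = min d1 (min d2 d3)"
  have "d > 0" using d1 d2 d3 by (simp add: d_def)
  \<comment> \<open>This scale keeps the parallelogram spanned by \<open>s *\<^sub>R v\<close> and
    \<open>s *\<^sub>R w\<close> within distance \<open>d\<close> of \<open>x\<close>; the summand 1
    keeps the denominator positive even if both vectors vanish.\<close>
  define s where "s = d / (2 * (norm v + norm w + 1))"
  have N: "norm v + norm w + 1 > 0" by (smt (verit) norm_ge_zero)
  then have "s > 0" using \<open>d > 0\<close> by (simp add: s_def)
  \<comment> \<open>Only the sum of the norms enters, so one estimate covers the pair
    \<open>v\<close>, \<open>w\<close> in both orders.\<close>
  have near: "dist (x + i *\<^sub>R v' + j *\<^sub>R w') x < d"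
    if "0 \<le> i" "i \<le> s" "0 \<le> j" "j \<le> s" "norm v' + norm w' = norm v + norm w" for i j v' w'
  proof -
    have "dist (x + i *\<^sub>R v' + j *\<^sub>R w') x = norm (i *\<^sub>R v' + j *\<^sub>R w')"
      by (simp add: dist_norm)
    also have "\<dots> \<le> i * norm v' + j * norm w'"
      using norm_triangle_ineq[of "i *\<^sub>R v'" "j *\<^sub>R w'"] that by simp
    also have "\<dots> \<le> s * norm v' + s * norm w'"
      using that by (intro add_mono mult_right_mono) auto
    also have "\<dots> = s * (norm v + norm w)"
      by (simp add: that(5) flip: distrib_left)
    also have "\<dots> \<le> s * (norm v + norm w + 1)"
      using \<open>s > 0\<close> by (intro mult_left_mono) auto
    also have "\<dots> = d / 2" using N by (simp add: s_def field_simps)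
    finally show ?thesis using \<open>d > 0\<close> by simp
  qed
  note diff = smooth_on_differentiable[OF assms(2)]
    smooth_on_differentiable[OF smooth_on_frechet_derivative[OF assms(2)]]
  \<comment> \<open>The second difference of \<open>f\<close> is symmetric in \<open>v\<close> and \<open>w\<close>, so the two second derivatives agree at two
    points close to \<open>x\<close>.\<close>
  obtain i j where ij: "0 < i" "i < s" "0 < j" "j < s" and 1:
    "f (x + s *\<^sub>R v + s *\<^sub>R w) - f (x + s *\<^sub>R v) - f (x + s *\<^sub>R w) + f x = s * s * F v w (x + i *\<^sub>R v + j *\<^sub>R w)"
    using second_difference_mvt[OF \<open>s > 0\<close>, of x v w U f] near d3 diff unfolding F_def d_def by auto
  obtain k l where kl: "0 < k" "k < s" "0 < l" "l < s" and 2: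
    "f (x + s *\<^sub>R w + s *\<^sub>R v) - f (x + s *\<^sub>R w) - f (x + s *\<^sub>R v) + f x = s * s * F w v (x + k *\<^sub>R w + l *\<^sub>R v)"
    using second_difference_mvt[OF \<open>s > 0\<close>, of x w v U f] near d3 diff unfolding F_def d_def
    by (auto simp: add.commute[of "norm w"])
  have "s * s * F v w (x + i *\<^sub>R v + j *\<^sub>R w) = s * s * F w v (x + k *\<^sub>R w + l *\<^sub>R v)"
    using 1 2 by (simp add: algebra_simps)
  then have eq: "F v w (x + i *\<^sub>R v + j *\<^sub>R w) = F w v (x + k *\<^sub>R w + l *\<^sub>R v)"
    using \<open>s > 0\<close> by simp
  have "dist (F v w (x + i *\<^sub>R v + j *\<^sub>R w)) (F v w x) < \<epsilon>"
    using ij by (intro d1 less_le_trans[OF near]) (auto simp: d_def)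
  moreover have "dist (F w v (x + k *\<^sub>R w + l *\<^sub>R v)) (F w v x) < \<epsilon>"
    using kl by (intro d2 less_le_trans[OF near]) (auto simp: d_def)
  ultimately show False
    using eq unfolding dist_real_def \<epsilon>_def by (simp add: abs_if split: if_splits)
qed


subsection \<open>Functions on a planar domain with connected horizontal slices\<close>

definition partial_x :: "(real \<times> real \<Rightarrow> real) \<Rightarrow> real \<times> real \<Rightarrow> real" where
  "partial_x f q = frechet_derivative f (at q) (1, 0)"

definition partial_y :: "(real \<times> real \<Rightarrow> real) \<Rightarrow> real \<times> real \<Rightarrow> real" where
  "partial_y f q = frechet_derivative f (at q) (0, 1)"

lemma smooth_on_partial_x: "smooth_on f U \<Longrightarrow> smooth_on (partial_x f) U"
  using smooth_on_frechet_derivative[of f U "(1, 0)"] by (simp add: partial_x_def[abs_def])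

lemma smooth_on_partial_y: "smooth_on f U \<Longrightarrow> smooth_on (partial_y f) U"
  using smooth_on_frechet_derivative[of f U "(0, 1)"] by (simp add: partial_y_def[abs_def])

lemma partial_commute:
  assumes "open U" "smooth_on f U" "q \<in> U"
  shows "partial_x (partial_y f) q = partial_y (partial_x f) q"
  using frechet_derivative_commute[OF assms, of "(0, 1)" "(1, 0)"]
  by (simp add: partial_x_def[abs_def] partial_y_def[abs_def])

lemma has_real_derivative_partial_x:
  assumes "smooth_on f U" "(x, y) \<in> U"
  shows "((\<lambda>r. f (r, y)) has_real_derivative partial_x f (x, y)) (at x)"
  using line_has_real_derivative[of f "(0, y)" x "(1, 0)"] smooth_on_differentiable[OF assms]
  by (simp add: partial_x_def)

lemma has_real_derivative_partial_y:
  assumes "smooth_on f U" "(x, y) \<in> U"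
  shows "((\<lambda>r. f (x, r)) has_real_derivative partial_y f (x, y)) (at y)"
  using line_has_real_derivative[of f "(x, 0)" y "(0, 1)"] smooth_on_differentiable[OF assms]
  by (simp add: partial_y_def)

lemma open_slice_x:
  fixes U :: "('a::topological_space \<times> 'b::topological_space) set"
  assumes "open U"
  shows "open {x. (x, y) \<in> U}"
proof -
  have "open ((\<lambda>x. (x, y)) -` U)"
    by (intro open_vimage assms continuous_on_Pair continuous_on_const continuous_on_id)
  then show ?thesis by (simp add: vimage_def)
qed

lemma open_slice_y:
  fixes U :: "('a::topological_space \<times> 'b::topological_space) set"
  assumes "open U"
  shows "open {y. (x, y) \<in> U}"
proof -
  have "open (Pair x -` U)"
    by (intro open_vimage assms continuous_on_Pair continuous_on_const continuous_on_id)
  then show ?thesis by (simp add: vimage_def)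
qed

text \<open>A vanishing x-derivative makes \<open>F\<close> constant on each connected horizontal
  slice. Smoothness of \<open>h\<close> is local: near a given \<open>y\<close> it equals
  \<open>F\<close> along a vertical line through one fixed point of the slice.\<close>

lemma smooth_function_of_y:
  fixes F :: "real \<times> real \<Rightarrow> real"
  assumes "open U" "\<And>y. connected {x. (x, y) \<in> U}" "smooth_on F U"
    and dx: "\<And>x y. (x, y) \<in> U \<Longrightarrow> ((\<lambda>r. F (r, y)) has_real_derivative 0) (at x)"
  shows "\<exists>h. smooth_on h (snd ` U) \<and> (\<forall>x y. (x, y) \<in> U \<longrightarrow> F (x, y) = h y)"
proof -
  \<comment> \<open>Any point of the slice can represent it; where the slice is empty the value is
    arbitrary.\<close>
  define h where "h y = F (SOME x. (x, y) \<in> U, y)" for y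
  have const: "F (x, y) = h y" if "(x, y) \<in> U" for x y
  proof -
    have "(SOME x. (x, y) \<in> U, y) \<in> U" using that by (rule someI)
    then show ?thesis
      unfolding h_def using that dx
      by (intro has_derivative_zero_unique_connected[OF open_slice_x[OF \<open>open U\<close>] assms(2), where f = "\<lambda>x. F (x, y)"])
        (auto simp: has_field_derivative_def lambda_zero)
  qed
  have "smooth_on h (snd ` U)"
  proof (rule smooth_on_local)
    fix y assume "y \<in> snd ` U"
    then obtain x where "(x, y) \<in> U" by auto
    let ?V = "{y. (x, y) \<in> U}"
    have "bounded_linear (\<lambda>y::real. (0::real, y))"
      by (intro bounded_linear_Pair bounded_linear_zero bounded_linear_ident)
    from smooth_on_affine[OF this open_slice_y \<open>open U\<close> \<open>smooth_on F U\<close>, of U x "(x, 0)"]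
    have "smooth_on (\<lambda>y. F (x, y)) ?V" using \<open>open U\<close> by simp
    then have "smooth_on h ?V"
      by (rule smooth_on_cong[rotated 2]) (use const open_slice_y[OF \<open>open U\<close>] in auto)
    then show "\<exists>V. open V \<and> y \<in> V \<and> smooth_on h V"
      using open_slice_y[OF \<open>open U\<close>] \<open>(x, y) \<in> U\<close> by blast
  qed
  with const show ?thesis by blast
qed


subsection \<open>Surfaces in compatible coordinates\<close>

text \<open>Lets an identity on \<open>U\<close> be differentiated in y: the vertical slice through
  the point is open, so both sides agree near it.\<close>

lemma partial_y_eqI:
  assumes "open U" "smooth_on f U" "(x, y) \<in> U" "\<And>q. q \<in> U \<Longrightarrow> f q = g q"
    "((\<lambda>r. g (x, r)) has_real_derivative d) (at y)"
  shows "partial_y f (x, y) = d"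
proof -
  have "((\<lambda>r. f (x, r)) has_real_derivative d) (at y)"
    using assms(5) by (rule has_field_derivative_transform_within_open[OF _ open_slice_y[OF \<open>open U\<close>]])
      (use assms in auto)
  then show ?thesis
    using has_real_derivative_partial_y[OF assms(2,3)] DERIV_unique by blast
qed

text \<open>These are \<open>s\<^sub>x = c w\<close> and \<open>t\<^sub>x = 2 w\<close> of the
  overview. They result from differentiating the unit length and horizontality of
  \<open>e\<^sub>1\<close> in y and exchanging the order of the partial derivatives.\<close>

lemma integrability_equations:
  fixes X1 X2 X3 :: "real \<times> real \<Rightarrow> real"
  defines "u \<equiv> partial_x X1" and "v \<equiv> partial_x X2"
  assumes "open U" and smooth: "smooth_on X1 U" "smooth_on X2 U" "smooth_on X3 U"
    and unit: "\<And>q. q \<in> U \<Longrightarrow> (u q)\<^sup>2 + (v q)\<^sup>2 = 1"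
    and contact: "\<And>q. q \<in> U \<Longrightarrow> partial_x X3 q = X2 q * u q - X1 q * v q"
    and curv: "\<And>q. q \<in> U \<Longrightarrow> partial_x u q = - c * v q" "\<And>q. q \<in> U \<Longrightarrow> partial_x v q = c * u q"
    and q: "(x, y) \<in> U"
  shows
    "((\<lambda>r. u (r, y) * partial_y X1 (r, y) + v (r, y) * partial_y X2 (r, y)) has_real_derivative
        c * (u (x, y) * partial_y X2 (x, y) - v (x, y) * partial_y X1 (x, y))) (at x)" (is ?s)
    and "((\<lambda>r. partial_y X3 (r, y) + X1 (r, y) * partial_y X2 (r, y) - X2 (r, y) * partial_y X1 (r, y))
        has_real_derivative 2 * (u (x, y) * partial_y X2 (x, y) - v (x, y) * partial_y X1 (x, y))) (at x)"
      (is ?t)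
proof -
  have su: "smooth_on u U" and sv: "smooth_on v U"
    using smooth by (simp_all add: u_def v_def smooth_on_partial_x)
  note dx = has_real_derivative_partial_x[OF _ q] and dy = has_real_derivative_partial_y[OF _ q]
  have "partial_y (\<lambda>q. 1) (x, y) = 2 * u (x, y) * partial_y u (x, y) + 2 * v (x, y) * partial_y v (x, y)"
    using unit
    by (intro partial_y_eqI[OF \<open>open U\<close> smooth_on_const q, where g = "\<lambda>q. (u q)\<^sup>2 + (v q)\<^sup>2"])
      (auto intro!: derivative_eq_intros dy[OF su] dy[OF sv])
  \<comment> \<open>The y-derivative of a unit vector is orthogonal to it; this removes the terms
    with second derivatives of \<open>X1\<close> and \<open>X2\<close> from
    \<open>s\<^sub>x\<close>.\<close>
  then have orth: "u (x, y) * partial_y u (x, y) + v (x, y) * partial_y v (x, y) = 0"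
    by (simp add: partial_y_def)
  \<comment> \<open>In \<open>t\<^sub>x\<close> the y-derivatives of \<open>u\<close> and
    \<open>v\<close> occurring here cancel, and the remaining products double those from the product
    rule, whence the factor 2.\<close>
  have X3: "partial_y (partial_x X3) (x, y) =
      partial_y X2 (x, y) * u (x, y) + partial_y u (x, y) * X2 (x, y) -
      (partial_y X1 (x, y) * v (x, y) + partial_y v (x, y) * X1 (x, y))"
    by (intro partial_y_eqI[OF \<open>open U\<close> smooth_on_partial_x[OF smooth(3)] q contact]
        DERIV_diff DERIV_mult dy[OF su] dy[OF sv] dy[OF smooth(1)] dy[OF smooth(2)])
  have X12: "partial_x (partial_y X1) (x, y) = partial_y u (x, y)"
    "partial_x (partial_y X2) (x, y) = partial_y v (x, y)"
    using partial_commute[OF \<open>open U\<close> _ q] smooth by (simp_all add: u_def v_def)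
  note X3' = partial_commute[OF \<open>open U\<close> smooth(3) q]
  have u': "((\<lambda>r. u (r, y)) has_real_derivative - c * v (x, y)) (at x)"
    and v': "((\<lambda>r. v (r, y)) has_real_derivative c * u (x, y)) (at x)"
    using dx[OF su] dx[OF sv] curv[OF q] by simp_all
  have X1': "((\<lambda>r. X1 (r, y)) has_real_derivative u (x, y)) (at x)"
    and X2': "((\<lambda>r. X2 (r, y)) has_real_derivative v (x, y)) (at x)"
    using dx[OF smooth(1)] dx[OF smooth(2)] by (simp_all add: u_def v_def)
  have Y1': "((\<lambda>r. partial_y X1 (r, y)) has_real_derivative partial_y u (x, y)) (at x)"
    and Y2': "((\<lambda>r. partial_y X2 (r, y)) has_real_derivative partial_y v (x, y)) (at x)"
    and Y3': "((\<lambda>r. partial_y X3 (r, y)) has_real_derivative partial_y (partial_x X3) (x, y)) (at x)"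
    using dx[OF smooth_on_partial_y[OF smooth(1)]] dx[OF smooth_on_partial_y[OF smooth(2)]]
      dx[OF smooth_on_partial_y[OF smooth(3)]] by (simp_all add: X12 X3')
  show ?s
    by (rule derivative_eq_intros u' v' Y1' Y2' refl)+ (use orth in \<open>simp add: algebra_simps\<close>)
  show ?t
    by (rule derivative_eq_intros X1' X2' Y1' Y2' Y3' refl)+ (simp add: X3 algebra_simps)
qed

section \<open>Component equations of the geometric conditions\<close>

lemma frechet_derivative_vec_nth:
  assumes "X differentiable (at q)"
  shows "frechet_derivative (\<lambda>q. X q $ i) (at q) v = frechet_derivative X (at q) v $ i"
  using bounded_linear.has_derivative[OF bounded_linear_vec_nth assms[unfolded frechet_derivative_works]]
    frechet_derivative_at by metis

lemma coord_components:
  assumes "X differentiable (at q)"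
  shows "coord_x X q $ i = partial_x (\<lambda>q. X q $ i) q" "coord_y X q $ i = partial_y (\<lambda>q. X q $ i) q"
  using frechet_derivative_vec_nth[OF assms]
  by (simp_all add: coord_x_def coord_y_def partial_x_def partial_y_def)

lemma frame_comps_J:
  "frame_comps p (J p v) = vector [- v $ 2, v $ 1, 0]"
  by (simp add: frame_comps_def J_def contact_form_def E1_def E2_def vec_eq_iff forall_3 algebra_simps)

text \<open>The covariant derivative is tested on curves in the surface; in compatible coordinates
  the x-lines are such curves with velocity \<open>e1\<close>.\<close>

lemma coordinate_line_curve_through:
  assumes "open U" "smooth_on X U" "X ` U \<subseteq> S" "(x, y) \<in> U"
  shows "curve_through S (X (x, y)) (coord_x X (x, y)) (\<lambda>r. X (x + r, y))"
proof -
  obtain \<epsilon> where \<epsilon>: "\<epsilon> > 0" "ball x \<epsilon> \<subseteq> {x. (x, y) \<in> U}"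
    using open_slice_x[OF \<open>open U\<close>, of y] assms(4) open_contains_ball by blast
  have in_U: "(x + r, y) \<in> U" if "r \<in> {-\<epsilon><..<\<epsilon>}" for r
    using \<epsilon>(2) that by (auto simp: dist_real_def subset_iff)
  have "bounded_linear (\<lambda>r::real. r *\<^sub>R (1::real, 0::real))"
    by (rule bounded_linear_scaleR_left)
  from smooth_on_affine[OF this _ \<open>open U\<close> \<open>smooth_on X U\<close>, of "{-\<epsilon><..<\<epsilon>}" "(x, y)"]
  have "smooth_on (\<lambda>r. X (x + r, y)) {-\<epsilon><..<\<epsilon>}" using in_U by simp
  moreover have "((\<lambda>r. X (x + r, y)) has_vector_derivative coord_x X (x, y)) (at 0)"
    using line_has_vector_derivative[of X "(x, y)" 0 "(1, 0)"] smooth_on_differentiable[OF assms(2,4)]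
    by (simp add: coord_x_def)
  ultimately show ?thesis
    unfolding curve_through_def using \<epsilon>(1) in_U assms(3) by fastforce
qed

text \<open>The first two equations are unit length and horizontality of \<open>e1\<close>. The last
  two are the curvature condition on an x-line, along which \<open>J e1\<close> has frame components
  \<open>(- v, u, 0)\<close>.\<close>

lemma compatible_coordinates_structure:
  fixes X :: "real \<times> real \<Rightarrow> real^3"
  defines "u \<equiv> partial_x (\<lambda>q. X q $ 1)" and "v \<equiv> partial_x (\<lambda>q. X q $ 2)"
  assumes char: "characteristic_field S e1" and curv: "p_mean_curvature S e1 H"
    and comp: "compatible_coordinates S e1 U X" and q: "q \<in> U"
  shows "(u q)\<^sup>2 + (v q)\<^sup>2 = 1" (is ?unit)
    and "partial_x (\<lambda>q. X q $ 3) q = X q $ 2 * u q - X q $ 1 * v q" (is ?contact)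
    and "partial_x u q = - H (X q) * v q" "partial_x v q = H (X q) * u q" (is ?v)
proof -
  have U: "open U" and X: "smooth_on X U" and XS: "X ` U \<subseteq> S"
    and e1: "\<And>q. q \<in> U \<Longrightarrow> coord_x X q = e1 (X q)"
    using comp by (auto simp: compatible_coordinates_def local_parametrization_def openin_subset
        dest: openin_imp_subset)
  have e1_comps: "e1 (X q) $ 1 = u q" "e1 (X q) $ 2 = v q" "e1 (X q) $ 3 = partial_x (\<lambda>q. X q $ 3) q"
    if "q \<in> U" for q
    using coord_components(1)[OF smooth_on_differentiable[OF X that]] e1[OF that]
    by (simp_all add: u_def v_def)
  have p: "X q \<in> S" using XS q by auto
  have "contact_form (X q) (e1 (X q)) = 0" "adapted_metric (X q) (e1 (X q)) (e1 (X q)) = 1"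
    using char p by (auto simp: characteristic_field_def contact_plane_def)
  then show ?unit ?contact
    using e1_comps[OF q]
    by (simp_all add: adapted_metric_def frame_comps_def inner_vec_def sum_3 contact_form_def
        power2_eq_square algebra_simps)
  obtain x y where xy: "q = (x, y)" by fastforce
  let ?W = "\<lambda>r. frame_comps (X (x + r, y)) (J (X (x + r, y)) (e1 (X (x + r, y))))"
  have "curve_through S (X q) (e1 (X q)) (\<lambda>r. X (x + r, y))"
    using coordinate_line_curve_through[OF U X XS, of x y] q e1[OF q] xy by simp
  then have W: "(?W has_vector_derivative frame_comps (X q) (- H (X q) *\<^sub>R e1 (X q))) (at 0)"
    using curv p by (auto simp: p_mean_curvature_def has_cov_derivative_def)
  have W_comp: "((\<lambda>r. ?W r $ i) has_real_derivative
      frame_comps (X q) (- H (X q) *\<^sub>R e1 (X q)) $ i) (at 0)" for i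
    using bounded_linear.has_vector_derivative[OF bounded_linear_vec_nth W]
    by (simp add: has_real_derivative_iff_has_vector_derivative)
  \<comment> \<open>\<open>e1_comps\<close> is available only over \<open>U\<close>, so rewriting
    the derivatives below needs an open range of parameters \<open>r\<close>.\<close>
  have "open ((\<lambda>r. x + r) -` {x. (x, y) \<in> U})"
    by (intro open_vimage open_slice_x U continuous_on_add continuous_on_const continuous_on_id)
  then have V: "open {r. (x + r, y) \<in> U}" by (simp add: vimage_def)
  have smooth: "smooth_on u U" "smooth_on v U"
    unfolding u_def v_def
    by (intro smooth_on_partial_x smooth_on_bounded_linear[OF bounded_linear_vec_nth U X])+
  have shift: "((\<lambda>r. f (x + r, y)) has_real_derivative partial_x f q) (at 0)" if "smooth_on f U" for f
    using line_has_real_derivative[of f "(x, y)" 0 "(1, 0)"] smooth_on_differentiable[OF that q] xy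
    by (simp add: partial_x_def)
  have "((\<lambda>r. - v (x + r, y)) has_real_derivative - H (X q) * u q) (at 0)"
    using has_field_derivative_transform_within_open[OF W_comp[of 1] V, of "\<lambda>r. - v (x + r, y)"] q xy
    by (simp add: frame_comps_J e1_comps) (simp add: frame_comps_def e1_comps)
  then have "partial_x v q = - (- H (X q) * u q)"
    using DERIV_unique[OF shift[OF smooth(2)]] DERIV_minus by fastforce
  then show ?v by simp
  have "((\<lambda>r. u (x + r, y)) has_real_derivative - H (X q) * v q) (at 0)"
    using has_field_derivative_transform_within_open[OF W_comp[of 2] V, of "\<lambda>r. u (x + r, y)"] q xy
    by (simp add: frame_comps_J e1_comps) (simp add: frame_comps_def e1_comps)
  then show "partial_x u q = - H (X q) * v q"
    using DERIV_unique[OF shift[OF smooth(1)]] by blast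
qed

text \<open>The three equations are the components of
  \<open>a \<partial>\<^sub>x + b \<partial>\<^sub>y\<close> along \<open>Reeb\<close>,
  \<open>e1\<close> and \<open>J e1\<close>, compared with those of \<open>e2_hat\<close>.\<close>

lemma metric_representation_components:
  fixes X :: "real \<times> real \<Rightarrow> real^3"
  defines "u \<equiv> partial_x (\<lambda>q. X q $ 1)" and "v \<equiv> partial_x (\<lambda>q. X q $ 2)"
    and "X1y \<equiv> partial_y (\<lambda>q. X q $ 1)" and "X2y \<equiv> partial_y (\<lambda>q. X q $ 2)"
    and "X3y \<equiv> partial_y (\<lambda>q. X q $ 3)"
  assumes char: "characteristic_field S e1" and curv: "p_mean_curvature S e1 H"
    and comp: "compatible_coordinates S e1 U X" and rep: "metric_representation e1 \<alpha> U X a b"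
    and q: "q \<in> U"
  shows "b q * (X3y q + X q $ 1 * X2y q - X q $ 2 * X1y q) = 1 / sqrt (1 + (\<alpha> (X q))\<^sup>2)"
    and "b q * (u q * X1y q + v q * X2y q) = - a q"
    and "b q * (u q * X2y q - v q * X1y q) = \<alpha> (X q) / sqrt (1 + (\<alpha> (X q))\<^sup>2)"
proof -
  have X: "smooth_on X U" and e1: "e1 (X q) = coord_x X q"
    using comp q unfolding compatible_coordinates_def local_parametrization_def by simp_all
  note unit = compatible_coordinates_structure(1)[OF char curv comp q, folded u_def v_def]
  note contact = compatible_coordinates_structure(2)[OF char curv comp q, folded u_def v_def]
  note coord = coord_components[OF smooth_on_differentiable[OF X q]]
  \<comment> \<open>Here \<open>\<rho>\<close> is the reciprocal of the root, whereas in the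
    overview and the final proof it is the root itself.\<close>
  define \<rho> where "\<rho> = 1 / sqrt (1 + (\<alpha> (X q))\<^sup>2)"
  have "e2_hat e1 \<alpha> (X q) = a q *\<^sub>R coord_x X q + b q *\<^sub>R coord_y X q"
    using rep q by (simp add: metric_representation_def)
  then have "e2_hat e1 \<alpha> (X q) $ i = a q * coord_x X q $ i + b q * coord_y X q $ i" for i
    by simp
  from this[of 1] this[of 2] this[of 3]
  have 1: "\<rho> * (\<alpha> (X q) * - v q) = a q * u q + b q * X1y q"
    and 2: "\<rho> * (\<alpha> (X q) * u q) = a q * v q + b q * X2y q"
    and 3: "\<rho> * (\<alpha> (X q) * (- (u q * X q $ 1) - v q * X q $ 2) + 1) =
      a q * (X q $ 2 * u q - X q $ 1 * v q) + b q * X3y q"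
    unfolding e2_hat_def e1
    by (simp_all add: \<rho>_def J_def frame_comps_def E1_def E2_def Reeb_def coord contact
        flip: u_def v_def X1y_def X2y_def X3y_def)
  \<comment> \<open>Applying the contact form to the triple \<open>1\<close>, \<open>2\<close>,
    \<open>3\<close> eliminates \<alpha> and \<open>a\<close>. The two later identities are the
    inner products of \<open>1\<close>, \<open>2\<close> with \<open>(u, v)\<close> and
    \<open>(- v, u)\<close>.\<close>
  have "b q * (X3y q + X q $ 1 * X2y q - X q $ 2 * X1y q) = \<rho>"
    using 1 2 3 by algebra
  then show "b q * (X3y q + X q $ 1 * X2y q - X q $ 2 * X1y q) = 1 / sqrt (1 + (\<alpha> (X q))\<^sup>2)"
    by (simp add: \<rho>_def)
  show "b q * (u q * X1y q + v q * X2y q) = - a q"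
    using 1 2 unit by algebra
  have "b q * (u q * X2y q - v q * X1y q) = \<alpha> (X q) * \<rho>"
    using 1 2 unit by algebra
  then show "b q * (u q * X2y q - v q * X1y q) = \<alpha> (X q) / sqrt (1 + (\<alpha> (X q))\<^sup>2)"
    by (simp add: \<rho>_def)
qed

section \<open>First integrals along the x-lines and the formulas for \<open>a\<close> and
  \<open>b\<close>\<close>

theorem proposition5p6:
  fixes lam c :: real
    and c1 c2 :: "real \<Rightarrow> real"
    and S :: "(real^3) set"
    and e1 :: "real^3 \<Rightarrow> real^3"
    and \<alpha> :: "real^3 \<Rightarrow> real"
    and U :: "(real \<times> real) set"
    and X :: "real \<times> real \<Rightarrow> real^3"
    and a b :: "real \<times> real \<Rightarrow> real"
  assumes "c = 2 * lam" and "c > 0"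
    and "regular_surface S"
    and "\<And>p. p \<in> S \<Longrightarrow> \<not> singular_point S p"
    and "characteristic_field S e1"
    and "p_mean_curvature S e1 (\<lambda>p. 2 * lam)"
    and "alpha_function S e1 \<alpha>"
    and "compatible_coordinates S e1 U X"
    and "metric_representation e1 \<alpha> U X a b"
    and "\<And>q. q \<in> U \<Longrightarrow> b q > 0"
    and "\<And>y. connected {x. (x, y) \<in> U}"
    and "smooth_on c1 (snd ` U)" and "smooth_on c2 (snd ` U)"
    and "\<And>x y. (x, y) \<in> U \<Longrightarrow> c2 y - cos (c * x + c1 y) \<noteq> 0"
    and "\<And>x y. (x, y) \<in> U \<Longrightarrow>
           \<alpha> (X (x, y)) = lam * (sin (2 * lam * x + c1 y) / (c2 y - cos (2 * lam * x + c1 y)))"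
  shows "\<exists>h k. smooth_on h (snd ` U) \<and> smooth_on k (snd ` U) \<and>
    (\<forall>x y. (x, y) \<in> U \<longrightarrow>
      a (x, y) =
        - (c / 2) / sqrt (1 + (\<alpha> (X (x, y)))\<^sup>2)
        + (c / 2 * c2 y) / ((c2 y - cos (c * x + c1 y)) * sqrt (1 + (\<alpha> (X (x, y)))\<^sup>2))
        + h y / (\<bar>c2 y - cos (c * x + c1 y)\<bar> * sqrt (1 + (\<alpha> (X (x, y)))\<^sup>2)) \<and>
      b (x, y) =
        exp (k y) / (\<bar>c2 y - cos (c * x + c1 y)\<bar> * sqrt (1 + (\<alpha> (X (x, y)))\<^sup>2)))"
proof -
  note char = assms(5) and curv = assms(6) and comp = assms(8) and rep = assms(9)
  have U: "open U" and X: "smooth_on X U"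
    using comp by (auto simp: compatible_coordinates_def local_parametrization_def)
  define X1 X2 X3 where "X1 = (\<lambda>q. X q $ 1)" and "X2 = (\<lambda>q. X q $ 2)" and "X3 = (\<lambda>q. X q $ 3)"
  note X_defs = X1_def X2_def X3_def
  define u v where "u = partial_x X1" and "v = partial_x X2"
  have smooth: "smooth_on X1 U" "smooth_on X2 U" "smooth_on X3 U"
    unfolding X_defs by (intro smooth_on_bounded_linear[OF bounded_linear_vec_nth U X])+
  then have smooth': "smooth_on u U" "smooth_on v U" "smooth_on (partial_y X1) U"
    "smooth_on (partial_y X2) U" "smooth_on (partial_y X3) U"
    by (simp_all add: u_def v_def smooth_on_partial_x smooth_on_partial_y)
  define s where "s q = u q * partial_y X1 q + v q * partial_y X2 q" for q
  define w where "w q = u q * partial_y X2 q - v q * partial_y X1 q" for q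
  define t where "t q = partial_y X3 q + X1 q * partial_y X2 q - X2 q * partial_y X1 q" for q
  define C where "C q = cos (c * fst q + c1 (snd q))" for q
  define D where "D q = c2 (snd q) - C q" for q
  define \<rho> where "\<rho> q = sqrt (1 + (\<alpha> (X q))\<^sup>2)" for q
  have D_nz: "D q \<noteq> 0" if "q \<in> U" for q
    using assms(14)[of "fst q" "snd q"] that by (simp add: D_def C_def)
  have \<alpha>: "\<alpha> (X (x, y)) = c / 2 * sin (c * x + c1 y) / D (x, y)" if "(x, y) \<in> U" for x y
    using assms(15)[OF that] by (simp add: assms(1) D_def C_def)
  have \<rho>_pos: "\<rho> q > 0" for q by (simp add: \<rho>_def add_pos_nonneg)
  have rep_t: "b q * t q = 1 / \<rho> q" and rep_s: "b q * s q = - a q" and rep_w: "b q * w q = \<alpha> (X q) / \<rho> q"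
    if "q \<in> U" for q
    using metric_representation_components[OF char curv comp rep that]
    by (simp_all add: t_def s_def w_def u_def v_def X_defs \<rho>_def)
  \<comment> \<open>The normalization \<open>b > 0\<close> fixes the sign of \<open>t\<close>, so
    that only \<open>D\<close> needs absolute values at the end.\<close>
  have t_pos: "t q > 0" if "q \<in> U" for q
    using rep_t[OF that] assms(10)[OF that] \<rho>_pos[of q] by (metis zero_less_divide_1_iff zero_less_mult_pos)
  have w: "w q = \<alpha> (X q) * t q" if "q \<in> U" for q
  proof -
    have "b q * w q = b q * (\<alpha> (X q) * t q)"
      unfolding mult.left_commute[of "b q"] rep_t[OF that] rep_w[OF that] by simp
    then show ?thesis using assms(10)[OF that] by simp
  qed
  note geometry = compatible_coordinates_structure[OF char curv comp]
  have s': "((\<lambda>r. s (r, y)) has_real_derivative c * w (x, y)) (at x)"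
    and t': "((\<lambda>r. t (r, y)) has_real_derivative 2 * w (x, y)) (at x)" if "(x, y) \<in> U" for x y
    unfolding s_def t_def w_def u_def v_def
    using geometry that assms(1)
    by (intro integrability_equations[OF U smooth, where c = c]; simp add: X_defs)+
  have C': "((\<lambda>r. C (r, y)) has_real_derivative - c * sin (c * x + c1 y)) (at x)" for x y
    unfolding C_def by (auto intro!: derivative_eq_intros)
  have D': "((\<lambda>r. D (r, y)) has_real_derivative c * sin (c * x + c1 y)) (at x)" for x y
    unfolding D_def by (auto intro!: derivative_eq_intros C')
  have smooth_C: "smooth_on C U"
    unfolding C_def
    by (intro smooth_on_compose[OF U _ smooth_on_cos] smooth_on_add smooth_on_mult smooth_on_const
        smooth_on_snd smooth_on_bounded_linear[OF bounded_linear_fst] smooth_on_ident U assms(12)) auto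
  have smooth_D: "smooth_on D U"
    unfolding D_def by (intro smooth_on_diff smooth_on_snd U assms(13) smooth_C)
  have smooth_s: "smooth_on s U" and smooth_t: "smooth_on t U"
    unfolding s_def t_def by (intro smooth_on_add smooth_on_diff smooth_on_mult U smooth smooth')+
  \<comment> \<open>This is \<open>2 \<alpha> = D\<^sub>x / D\<close> with denominators cleared. In
    view of \<open>t'\<close> it says \<open>t\<^sub>x D = D\<^sub>x t\<close>.\<close>
  have tw: "2 * w (x, y) * D (x, y) = c * sin (c * x + c1 y) * t (x, y)" if "(x, y) \<in> U" for x y
    using w[OF that] \<alpha>[OF that] D_nz[OF that] by simp
  \<comment> \<open>By \<open>tw\<close> the numerator in the quotient rule for \<open>D / t\<close>
    vanishes.\<close>
  have "\<exists>g. smooth_on g (snd ` U) \<and> (\<forall>x y. (x, y) \<in> U \<longrightarrow> D (x, y) / t (x, y) = g y)"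
  proof (rule smooth_function_of_y[OF U assms(11), of "\<lambda>q. D q / t q"])
    show "smooth_on (\<lambda>q. D q / t q) U"
      using t_pos by (intro smooth_on_divide U smooth_D smooth_t) force
    show "((\<lambda>r. D (r, y) / t (r, y)) has_real_derivative 0) (at x)" if "(x, y) \<in> U" for x y
      using DERIV_divide[OF D'[where x = x and y = y] t'[OF that]] tw[OF that] t_pos[OF that] by (simp add: algebra_simps)
  qed
  then obtain g where g: "smooth_on g (snd ` U)" "\<And>x y. (x, y) \<in> U \<Longrightarrow> D (x, y) / t (x, y) = g y"
    by blast
  \<comment> \<open>The second summand is \<open>(c / 2) C / g\<close>. As \<open>t / D\<close> is
    constant in x and \<open>C\<^sub>x = - D\<^sub>x\<close>, its derivative is \<open>- c w\<close>
    by \<open>tw\<close>, which cancels \<open>s\<^sub>x\<close>.\<close>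
  have "\<exists>f. smooth_on f (snd ` U) \<and>
    (\<forall>x y. (x, y) \<in> U \<longrightarrow> s (x, y) + c * C (x, y) * t (x, y) / (2 * D (x, y)) = f y)"
  proof (rule smooth_function_of_y[OF U assms(11), of "\<lambda>q. s q + c * C q * t q / (2 * D q)"])
    show "smooth_on (\<lambda>q. s q + c * C q * t q / (2 * D q)) U"
      using D_nz
      by (intro smooth_on_add smooth_on_divide smooth_on_mult smooth_on_const U smooth_D smooth_t smooth_s smooth_C)
        auto
    fix x y assume xy: "(x, y) \<in> U"
    have "((\<lambda>r. s (r, y) + c * C (r, y) * t (r, y) / (2 * D (r, y))) has_real_derivative
      c * w (x, y) + ((c * (- c * sin (c * x + c1 y)) * t (x, y) + 2 * w (x, y) * (c * C (x, y))) * (2 * D (x, y))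
        - c * C (x, y) * t (x, y) * (2 * (c * sin (c * x + c1 y)))) / (2 * D (x, y) * (2 * D (x, y)))) (at x)"
      using D_nz[OF xy] by (intro DERIV_add DERIV_divide DERIV_mult DERIV_cmult s'[OF xy] t'[OF xy] D' C') simp
    also have "c * w (x, y) + ((c * (- c * sin (c * x + c1 y)) * t (x, y) + 2 * w (x, y) * (c * C (x, y))) * (2 * D (x, y))
        - c * C (x, y) * t (x, y) * (2 * (c * sin (c * x + c1 y)))) / (2 * D (x, y) * (2 * D (x, y))) = 0"
      using D_nz[OF xy] tw[OF xy] by (simp add: divide_simps) algebra
    finally show "((\<lambda>r. s (r, y) + c * C (r, y) * t (r, y) / (2 * D (r, y))) has_real_derivative 0) (at x)" .
  qed
  then obtain f where f: "smooth_on f (snd ` U)"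
    "\<And>x y. (x, y) \<in> U \<Longrightarrow> s (x, y) + c * C (x, y) * t (x, y) / (2 * D (x, y)) = f y"
    by blast
  have g_nz: "g y \<noteq> 0" if "y \<in> snd ` U" for y
    using that g(2) D_nz t_pos by force
  have V: "open (snd ` U)" using U by (rule open_image_snd)
  \<comment> \<open>From \<open>b = 1 / (t \<rho>)\<close> and
    \<open>\<bar>D\<bar> = \<bar>g\<bar> t\<close>, the numerator of \<open>b\<close> over
    \<open>\<bar>D\<bar> \<rho>\<close> must be \<open>\<bar>g\<bar>\<close>.\<close>
  define k where "k y = ln \<bar>g y\<bar>" for y
  \<comment> \<open>The part \<open>- f / (t \<rho>)\<close> of \<open>a = - s / (t \<rho>)\<close>,
    brought over the denominator \<open>\<bar>D\<bar> \<rho>\<close>, has numerator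
    \<open>- f \<bar>g\<bar>\<close>.\<close>
  define h where "h y = - 1 * f y * exp (k y)" for y
  have smooth_k: "smooth_on k (snd ` U)"
    unfolding k_def
    by (rule smooth_on_compose[OF V g(1) smooth_on_ln_abs]) (rule image_subsetI, simp add: g_nz)
  have "smooth_on (\<lambda>y. exp (k y)) (snd ` U)"
    by (rule smooth_on_compose[OF V smooth_k smooth_on_exp subset_UNIV])
  then have smooth_h: "smooth_on h (snd ` U)"
    unfolding h_def by (intro smooth_on_mult smooth_on_const V f)
  have "a (x, y) = - (c / 2) / \<rho> (x, y) + (c / 2 * c2 y) / (D (x, y) * \<rho> (x, y)) +
      h y / (\<bar>D (x, y)\<bar> * \<rho> (x, y)) \<and> b (x, y) = exp (k y) / (\<bar>D (x, y)\<bar> * \<rho> (x, y))"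
    if xy: "(x, y) \<in> U" for x y
  proof -
    have gy: "g y \<noteq> 0" using xy by (intro g_nz) force
    have nz: "t (x, y) > 0" "\<rho> (x, y) > 0" using t_pos[OF xy] \<rho>_pos by auto
    have D: "D (x, y) = g y * t (x, y)" using g(2)[OF xy] nz by (simp add: field_simps)
    \<comment> \<open>Through \<open>C = c\<^sub>2 - D\<close> the remaining part
      \<open>(c / 2) C / (D \<rho>)\<close> of \<open>a\<close> splits into the first two terms of
      the formula.\<close>
    have c2: "c2 y = g y * t (x, y) + C (x, y)" using D by (simp add: D_def)
    have s: "s (x, y) = f y - c / 2 * C (x, y) / g y" using f(2)[OF xy] gy nz by (simp add: D)
    have b: "b (x, y) = 1 / (t (x, y) * \<rho> (x, y))" using rep_t[OF xy] nz by (simp add: field_simps)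
    have a: "a (x, y) = - s (x, y) / (t (x, y) * \<rho> (x, y))" using rep_s[OF xy] unfolding b by simp
    have k: "exp (k y) = \<bar>g y\<bar>" using gy by (simp add: k_def)
    have "h y / (\<bar>D (x, y)\<bar> * \<rho> (x, y)) = - f y / (t (x, y) * \<rho> (x, y))"
      unfolding h_def k D abs_mult using gy nz by simp
    then show ?thesis
      unfolding k a s b c2 unfolding D abs_mult using gy nz by (simp add: field_simps)
  qed
  then show ?thesis
    using smooth_h smooth_k by (intro exI[of _ h] exI[of _ k]) (simp add: \<rho>_def D_def C_def)
qed

end
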